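(* Let $X$ be a proper sofic shift of $\mathbb Z_r$, so that there is a word of length $j$ that does not occur in the language of $X$. Suppose that there exists $t\in\mathbb Z_r$ such that $x+t$ has a tail belonging to $X$ for each $x\in X$. Then $nt\in\mathbb Z$ for some positive integer $n$ satisfying $\gcd(n,r)=1$ and $n\le r^j-1$.
   Context: $r\ge 2$ is an integer, not necessarily prime. $\mathbb Z_r=\varprojlim \mathbb Z/r^n\mathbb Z$ is the ring of $r$-adic integers, identified with the set of left-infinite digit sequences $\ldots x_2x_1x_0$ with $x_i\in\{0,\ldots,r-1\}$, addition having carries propagating to the left; $\mathbb Z$ is regarded as a subset of $\mathbb Z_r$ (the sequences whose digits are eventually all $0$ or eventually all $r-1$). The shift map $\sigma$ on $\mathbb Z_r$ deletes the rightmost digit: $\sigma(\ldots x_2x_1x_0)=\ldots x_3x_2x_1$, making $\mathbb Z_r$ the one-sided full shift on $r$ symbols. A sofic shift of $\mathbb Z_r$ is a nonempty set of all left-infinite sequences $\ldots x_2x_1x_0$ such that $(x_0,x_1,x_2,\ldots)$ is the sequence of labels along some infinite path in a fixed finite directed graph with edges labelled by $\{0,\ldots,r-1\}$. It is proper if it is not all of $\mathbb Z_r$. A point $x\in\mathbb Z_r$ has a tail belonging to $X$ if there exists $k\in\mathbb N$ with $\sigma^k(x)\in X$. *)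

theory Defs
  imports "Graph_Theory.Digraph"
begin

text \<open>
  An \<open>r\<close>-adic integer \<open>\<dots> x\<^sub>2 x\<^sub>1 x\<^sub>0\<close> is represented by its digit function, with
  \<open>x i\<close> the coefficient of \<open>r ^ i\<close>. Everything below is meant for \<open>r \<ge> 2\<close>.
\<close>

definition radic_carrier :: "nat \<Rightarrow> (nat \<Rightarrow> nat) set" where
  "radic_carrier r = {x. \<forall>i. x i < r}"

fun radic_carry :: "nat \<Rightarrow> (nat \<Rightarrow> nat) \<Rightarrow> (nat \<Rightarrow> nat) \<Rightarrow> nat \<Rightarrow> nat" where
  "radic_carry r x y 0 = 0"
| "radic_carry r x y (Suc i) = (x i + y i + radic_carry r x y i) div r"

definition radic_add :: "nat \<Rightarrow> (nat \<Rightarrow> nat) \<Rightarrow> (nat \<Rightarrow> nat) \<Rightarrow> nat \<Rightarrow> nat" where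
  "radic_add r x y i = (x i + y i + radic_carry r x y i) mod r"

definition radic_nmult :: "nat \<Rightarrow> nat \<Rightarrow> (nat \<Rightarrow> nat) \<Rightarrow> nat \<Rightarrow> nat" where
  "radic_nmult r n t = ((radic_add r t) ^^ n) (\<lambda>i. 0)"

text \<open>
  The embedding of the integers. Since \<open>div\<close> rounds towards minus infinity, a negative integer
  receives a digit sequence that is eventually \<open>r - 1\<close>.
\<close>

definition radic_of_int :: "nat \<Rightarrow> int \<Rightarrow> nat \<Rightarrow> nat" where
  "radic_of_int r k i = nat ((k div int r ^ i) mod int r)"

definition radic_Ints :: "nat \<Rightarrow> (nat \<Rightarrow> nat) set" where
  "radic_Ints r = range (radic_of_int r)"

definition radic_shift :: "(nat \<Rightarrow> nat) \<Rightarrow> nat \<Rightarrow> nat" where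
  "radic_shift x = (\<lambda>i. x (Suc i))"

text \<open>
  A labelled graph is a finite digraph (loops and parallel arcs allowed) with a labelling of its
  arcs; \<open>e\<close> below is an infinite path, given by its successive arcs. Taking vertices and arcs to
  be natural numbers is no restriction, as the graph is finite.
\<close>

definition path_labels :: "('v, 'e) pre_digraph \<Rightarrow> ('e \<Rightarrow> nat) \<Rightarrow> (nat \<Rightarrow> nat) set" where
  "path_labels G lab = {x. \<exists>e. \<forall>i. e i \<in> arcs G \<and> head G (e i) = tail G (e (Suc i)) \<and> x i = lab (e i)}"

definition sofic_shift :: "nat \<Rightarrow> (nat \<Rightarrow> nat) set \<Rightarrow> bool" where
  "sofic_shift r X \<longleftrightarrow> X \<noteq> {} \<and>
     (\<exists>(G :: (nat, nat) pre_digraph) lab.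
        fin_digraph G \<and> lab ` arcs G \<subseteq> {..<r} \<and> X = path_labels G lab)"

definition proper_sofic_shift :: "nat \<Rightarrow> (nat \<Rightarrow> nat) set \<Rightarrow> bool" where
  "proper_sofic_shift r X \<longleftrightarrow> sofic_shift r X \<and> X \<noteq> radic_carrier r"

text \<open>
  Words are listed in the order of increasing index, that is, from right to left in the notation
  \<open>\<dots> x\<^sub>2 x\<^sub>1 x\<^sub>0\<close>.
\<close>

definition language :: "(nat \<Rightarrow> nat) set \<Rightarrow> nat list set" where
  "language X = {map x [k..<l] | x k l. x \<in> X}"

definition has_tail_in :: "(nat \<Rightarrow> nat) \<Rightarrow> (nat \<Rightarrow> nat) set \<Rightarrow> bool" where
  "has_tail_in x X \<longleftrightarrow> (\<exists>k. (radic_shift ^^ k) x \<in> X)"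


subsection \<open>Consistency of the definitions\<close>

text \<open>
  The image of \<open>x\<close> in the integers modulo \<open>r ^ n\<close>. The next lemmas show that \<open>radic_add\<close> and
  \<open>radic_of_int\<close> agree with the description as an inverse limit.
\<close>

definition radic_trunc :: "nat \<Rightarrow> (nat \<Rightarrow> nat) \<Rightarrow> nat \<Rightarrow> nat" where
  "radic_trunc r x n = (\<Sum>i<n. x i * r ^ i)"

lemma radic_trunc_Suc: "radic_trunc r x (Suc n) = radic_trunc r x n + x n * r ^ n"
  by (simp add: radic_trunc_def)

lemma radic_trunc_less:
  assumes "x \<in> radic_carrier r" shows "radic_trunc r x n < r ^ n"
proof (induction n)
  case 0 show ?case by (simp add: radic_trunc_def)
next
  case (Suc n)
  have "x n + 1 \<le> r" using assms by (simp add: radic_carrier_def Suc_le_eq)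
  hence "(x n + 1) * r ^ n \<le> r * r ^ n" by (rule mult_le_mono1)
  with Suc show ?case by (simp add: radic_trunc_Suc)
qed

lemma radic_digit:
  assumes "x \<in> radic_carrier r" shows "x n = radic_trunc r x (Suc n) div r ^ n"
proof -
  have "0 < r" using assms by (auto simp: radic_carrier_def)
  thus ?thesis using radic_trunc_less[OF assms, of n] by (simp add: radic_trunc_Suc)
qed

lemma radic_eqI:
  assumes "x \<in> radic_carrier r" "y \<in> radic_carrier r" "\<And>n. radic_trunc r x n = radic_trunc r y n"
  shows "x = y"
  using radic_digit[OF assms(1)] radic_digit[OF assms(2)] assms(3) by (intro ext) metis

lemma radic_add_closed: "0 < r \<Longrightarrow> radic_add r x y \<in> radic_carrier r"
  by (simp add: radic_carrier_def radic_add_def)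

lemma radic_trunc_add_carry:
  "radic_trunc r (radic_add r x y) n + radic_carry r x y n * r ^ n = radic_trunc r x n + radic_trunc r y n"
proof (induction n)
  case 0 show ?case by (simp add: radic_trunc_def)
next
  case (Suc n)
  define s where "s = x n + y n + radic_carry r x y n"
  have "radic_trunc r (radic_add r x y) (Suc n) + radic_carry r x y (Suc n) * r ^ Suc n
      = radic_trunc r (radic_add r x y) n + (s mod r + (s div r) * r) * r ^ n"
    unfolding radic_trunc_Suc radic_add_def radic_carry.simps s_def [symmetric]
    by (simp only: power_Suc distrib_right mult.assoc add.assoc)
  also have "\<dots> = radic_trunc r (radic_add r x y) n + s * r ^ n" by simp
  also have "\<dots> = radic_trunc r x (Suc n) + radic_trunc r y (Suc n)"
    using Suc by (simp add: radic_trunc_Suc s_def algebra_simps)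
  finally show ?case .
qed

lemma radic_trunc_add:
  assumes "0 < r"
  shows "radic_trunc r (radic_add r x y) n = (radic_trunc r x n + radic_trunc r y n) mod r ^ n"
proof -
  have "radic_trunc r (radic_add r x y) n < r ^ n"
    using radic_trunc_less radic_add_closed assms by blast
  thus ?thesis by (simp flip: radic_trunc_add_carry)
qed

lemma radic_of_int_closed: "0 < r \<Longrightarrow> radic_of_int r k \<in> radic_carrier r"
  by (simp add: radic_carrier_def radic_of_int_def nat_less_iff)

lemma radic_trunc_of_int:
  assumes "0 < r" shows "int (radic_trunc r (radic_of_int r k) n) = k mod int r ^ n"
proof (induction n)
  case 0 show ?case by (simp add: radic_trunc_def)
next
  case (Suc n)
  have "k mod (int r ^ n * int r) = int r ^ n * (k div int r ^ n mod int r) + k mod int r ^ n"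
    using assms by (intro zmod_zmult2_eq) simp
  with Suc assms show ?case
    by (simp add: radic_trunc_Suc radic_of_int_def mult.commute)
qed

lemma radic_trunc_mod:
  assumes "x \<in> radic_carrier r" "n \<le> m" shows "radic_trunc r x m mod r ^ n = radic_trunc r x n"
  using assms(2)
proof (induction m rule: dec_induct)
  case base show ?case using radic_trunc_less[OF assms(1)] by simp
next
  case (step m)
  have "r ^ n dvd x m * r ^ m" using step by (simp add: le_imp_power_dvd)
  thus ?case using step by (auto simp: radic_trunc_Suc)
qed

lemma radic_Ints_iff:
  assumes "2 \<le> r"
  shows "x \<in> radic_Ints r \<longleftrightarrow> x \<in> radic_carrier r \<and>
           (\<exists>N. (\<forall>i\<ge>N. x i = 0) \<or> (\<forall>i\<ge>N. x i = r - 1))"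
proof
  assume "x \<in> radic_Ints r"
  then obtain k where x: "x = radic_of_int r k" by (auto simp: radic_Ints_def)
  define N where "N = nat \<bar>k\<bar>"
  have big: "\<bar>k\<bar> < int r ^ i" if "i \<ge> N" for i
  proof -
    have "i < r ^ i" using assms by (intro power_gt_expt) simp
    hence "int i < int r ^ i" by (metis of_nat_less_iff of_nat_power)
    thus ?thesis using that N_def by linarith
  qed
  show "x \<in> radic_carrier r \<and> (\<exists>N. (\<forall>i\<ge>N. x i = 0) \<or> (\<forall>i\<ge>N. x i = r - 1))"
  proof (intro conjI exI[of _ N])
    show "x \<in> radic_carrier r" using assms by (simp add: x radic_of_int_closed)
    show "(\<forall>i\<ge>N. x i = 0) \<or> (\<forall>i\<ge>N. x i = r - 1)"
    proof (cases "k \<ge> 0")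
      case True
      have "x i = 0" if "i \<ge> N" for i
        using big[OF that] True by (simp add: x radic_of_int_def)
      thus ?thesis by blast
    next
      case False
      have "x i = r - 1" if "i \<ge> N" for i
      proof -
        have "k div int r ^ i = - 1"
          using big[OF that] False by (intro int_div_pos_eq[where r = "k + int r ^ i"]) auto
        moreover have "(- 1 :: int) mod int r = int r - 1"
          using assms by (simp add: zmod_minus1)
        ultimately show ?thesis by (simp add: x radic_of_int_def nat_diff_distrib)
      qed
      thus ?thesis by blast
    qed
  qed
next
  assume "x \<in> radic_carrier r \<and> (\<exists>N. (\<forall>i\<ge>N. x i = 0) \<or> (\<forall>i\<ge>N. x i = r - 1))"
  then obtain N where x: "x \<in> radic_carrier r"
    and N: "(\<forall>i\<ge>N. x i = 0) \<or> (\<forall>i\<ge>N. x i = r - 1)" by blast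
  have r: "0 < r" using assms by simp
  have "\<exists>k. \<forall>n. int (radic_trunc r x n) mod int r ^ n = k mod int r ^ n"
    using N
  proof
    assume z: "\<forall>i\<ge>N. x i = 0"
    have up: "radic_trunc r x n = radic_trunc r x N" if "n \<ge> N" for n
      using that by (induction n rule: dec_induct) (use z in \<open>auto simp: radic_trunc_Suc\<close>)
    have "int (radic_trunc r x n) mod int r ^ n = int (radic_trunc r x N) mod int r ^ n" for n
    proof (cases "n \<ge> N")
      case False
      hence "radic_trunc r x n = radic_trunc r x N mod r ^ n" using radic_trunc_mod[OF x, of n N] by simp
      thus ?thesis by (simp add: of_nat_mod)
    next
      case True
      thus ?thesis using up[of n] by simp
    qed
    thus ?thesis by blast
  next
    assume z: "\<forall>i\<ge>N. x i = r - 1"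
    have up: "int (radic_trunc r x n) = int (radic_trunc r x N) - int r ^ N + int r ^ n" if "n \<ge> N" for n
      using that
    proof (induction n rule: dec_induct)
      case (step n)
      have xn: "int (x n) = int r - 1" using z r step by simp
      show ?case unfolding radic_trunc_Suc using step.IH by (simp add: xn left_diff_distrib)
    qed simp
    have "int (radic_trunc r x n) mod int r ^ n = (int (radic_trunc r x N) - int r ^ N) mod int r ^ n" for n
    proof (cases "n \<ge> N")
      case False
      hence "radic_trunc r x n = radic_trunc r x N mod r ^ n" using radic_trunc_mod[OF x, of n N] by simp
      moreover have "int r ^ n dvd int r ^ N" using False by (simp add: le_imp_power_dvd)
      hence "(int (radic_trunc r x N) - int r ^ N) mod int r ^ n = int (radic_trunc r x N) mod int r ^ n"
        by (metis diff_zero dvd_imp_mod_0 mod_diff_right_eq)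
      ultimately show ?thesis by (simp add: of_nat_mod)
    next
      case True
      thus ?thesis using up[of n] by simp
    qed
    thus ?thesis by blast
  qed
  then obtain k where k: "\<And>n. int (radic_trunc r x n) mod int r ^ n = k mod int r ^ n" by blast
  have "radic_trunc r x n = radic_trunc r (radic_of_int r k) n" for n
  proof -
    have "int (radic_trunc r x n) mod int r ^ n = int (radic_trunc r x n)"
      using radic_trunc_less[OF x, of n] by (simp flip: of_nat_power)
    thus ?thesis using k[of n] radic_trunc_of_int[OF r, of k n] by simp
  qed
  hence "x = radic_of_int r k" using radic_eqI x radic_of_int_closed r by blast
  thus "x \<in> radic_Ints r" by (simp add: radic_Ints_def)
qed

lemma sofic_shift_subset: "sofic_shift r X \<Longrightarrow> X \<subseteq> radic_carrier r"
  unfolding sofic_shift_def path_labels_def radic_carrier_def by fastforce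

lemma finite_pigeonhole_antimono:
  fixes P :: "'a \<Rightarrow> nat \<Rightarrow> bool"
  assumes "finite A" "\<And>n. \<exists>e\<in>A. P e n" "\<And>e m n. P e n \<Longrightarrow> m \<le> n \<Longrightarrow> P e m"
  shows "\<exists>e\<in>A. \<forall>n. P e n"
proof (rule ccontr)
  assume "\<not> ?thesis"
  then obtain f where f: "\<And>e. e \<in> A \<Longrightarrow> \<not> P e (f e)" by metis
  obtain e where e: "e \<in> A" "P e (Max (f ` A))" using assms(2) by blast
  have "f e \<le> Max (f ` A)" using assms(1) e by simp
  with assms(3) e f show False by blast
qed

text \<open>
  A proper sofic shift omits some word (by compactness), so a length \<open>j\<close> as in the theorem
  always exists.
\<close>

lemma proper_sofic_shift_missing_word:
  assumes "proper_sofic_shift r X"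
  obtains w where "w \<in> lists {..<r}" "w \<notin> language X"
proof -
  have X: "sofic_shift r X" and ne: "X \<noteq> radic_carrier r"
    using assms by (auto simp: proper_sofic_shift_def)
  then obtain z where z: "z \<in> radic_carrier r" "z \<notin> X" using sofic_shift_subset by blast
  obtain G :: "(nat, nat) pre_digraph" and lab where G: "fin_digraph G" "X = path_labels G lab"
    using X by (auto simp: sofic_shift_def)
  have fin: "finite (arcs G)" using G(1) by (rule fin_digraph.finite_arcs)
  define path where "path e \<longleftrightarrow> (\<forall>i. e i \<in> arcs G \<and> head G (e i) = tail G (e (Suc i)))"
    for e :: "nat \<Rightarrow> nat"
  define ext where "ext a m n \<longleftrightarrow> (\<exists>e. path e \<and> e 0 = a \<and> (\<forall>i\<le>n. lab (e i) = z (m + i)))"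
    for a m n
  have ext_mono: "ext a m n' " if a: "ext a m n" "n' \<le> n" for a m n n'
  proof -
    obtain e where e: "path e" "e 0 = a" "\<forall>i\<le>n. lab (e i) = z (m + i)"
      using a(1) unfolding ext_def by blast
    show ?thesis unfolding ext_def by (rule exI[of _ e]) (use e a(2) in auto)
  qed
  have "\<exists>n. map z [0..<n] \<notin> language X"
  proof (rule ccontr)
    assume "\<not> ?thesis"
    hence lang: "map z [0..<n] \<in> language X" for n by blast
    have "\<exists>a\<in>arcs G. ext a 0 n" for n
    proof -
      obtain x k l where x: "x \<in> X" "map z [0..<Suc n] = map x [k..<l]"
        using lang[of "Suc n"] unfolding language_def by blast
      have len: "l - k = Suc n" using arg_cong[OF x(2), of length] by simp
      have zx: "z i = x (k + i)" if "i \<le> n" for i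
        using arg_cong[OF x(2), of "\<lambda>w. w ! i"] that len by (simp del: upt_Suc)
      obtain e where e: "path e" "\<And>i. x i = lab (e i)"
        using x(1) G(2) unfolding path_labels_def path_def by blast
      have "ext (e k) 0 n" unfolding ext_def
        by (rule exI[of _ "\<lambda>i. e (k + i)"]) (use e zx in \<open>auto simp: path_def\<close>)
      thus ?thesis using e(1) path_def by blast
    qed
    hence start: "\<exists>a\<in>arcs G. \<forall>n. ext a 0 n"
      using finite_pigeonhole_antimono[OF fin, of "\<lambda>a n. ext a 0 n"] ext_mono by blast
    have step: "\<exists>b\<in>{b \<in> arcs G. tail G b = head G a}. \<forall>n. ext b (Suc m) n"
      if a: "\<forall>n. ext a m n" for a m
    proof (rule finite_pigeonhole_antimono)
      fix n
      obtain e where e: "path e" "e 0 = a" "\<forall>i\<le>Suc n. lab (e i) = z (m + i)"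
        using a unfolding ext_def by blast
      have "ext (e 1) (Suc m) n" unfolding ext_def
        by (rule exI[of _ "\<lambda>i. e (Suc i)"]) (use e in \<open>auto simp: path_def\<close>)
      moreover have "e 1 \<in> arcs G" "tail G (e 1) = head G a"
        using e unfolding path_def by (auto simp: eq_commute)
      ultimately show "\<exists>b\<in>{b \<in> arcs G. tail G b = head G a}. ext b (Suc m) n" by blast
    qed (use fin ext_mono in auto)
    have "\<exists>e. \<forall>m. (e m \<in> arcs G \<and> (\<forall>n. ext (e m) m n)) \<and> tail G (e (Suc m)) = head G (e m)"
      by (rule dependent_nat_choice) (use start step in blast)+
    then obtain e where e: "\<And>m. e m \<in> arcs G" "\<And>m n. ext (e m) m n"
      "\<And>m. tail G (e (Suc m)) = head G (e m)" by blast
    have "z m = lab (e m)" for m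
      using e(2)[of m 0] unfolding ext_def by auto
    hence "z \<in> X" unfolding G(2) path_labels_def using e(1,3) by (intro CollectI exI[of _ e]) simp
    with z show False by blast
  qed
  then obtain n where n: "map z [0..<n] \<notin> language X" by blast
  moreover have "map z [0..<n] \<in> lists {..<r}" using z(1) by (auto simp: radic_carrier_def)
  ultimately show thesis using that by blast
qed

end

theory Submission
  imports Defs "HOL-Number_Theory.Cong"
begin

text \<open>
  Up to integers, the translates \<open>x + m t\<close> of a point \<open>x\<close> of \<open>X\<close> all stay in \<open>X\<close>, so at every
  large position \<open>n\<close> the multiples of \<open>\<theta> = (t mod r ^ n) / r ^ n\<close>, shifted by \<open>x\<close>, avoid an
  arc of length \<open>1 / r ^ j\<close> of the circle. By Dirichlet's theorem \<open>q \<theta>\<close> is within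
  \<open>1 / (r ^ j + 1)\<close> of an integer for some \<open>q \<le> r ^ j\<close>, and it must even be within any given
  \<open>\<epsilon>\<close> of one once \<open>n\<close> is large. For \<open>P = (r ^ j)!\<close> the centred residues of \<open>P t\<close> modulo
  \<open>r ^ n\<close> are then \<open>o(r ^ n)\<close> and hence eventually constant, so \<open>P t\<close> is an integer. The least
  \<open>q > 0\<close> for which \<open>q t\<close> is an integer is coprime to \<open>r\<close>, because there is no torsion, and at
  most \<open>r ^ j\<close>, by the approximation once more.
\<close>

section \<open>Finite changes of digits that lead back into the sofic shift\<close>

text \<open>The path is delayed by going around a cycle that it closes.\<close>

lemma path_labels_delay1:
  assumes "fin_digraph G" "z \<in> path_labels G lab"
  shows "\<exists>y\<in>path_labels G lab. \<exists>i. \<forall>n\<ge>i. y (Suc n) = z n"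
proof -
  obtain e where e: "\<And>i. e i \<in> arcs G" "\<And>i. head G (e i) = tail G (e (Suc i))" "\<And>i. z i = lab (e i)"
    using assms(2) by (auto simp: path_labels_def)
  have "finite (range e)"
    using e(1) fin_digraph.finite_arcs[OF assms(1)] by (auto intro: finite_subset)
  hence "\<not> inj e" using finite_imageD infinite_UNIV_nat by blast
  then obtain i i' where i: "i < i'" "e i = e i'" unfolding inj_def by (metis linorder_neqE_nat)
  \<comment> \<open>The cycle from \<open>e i\<close> to \<open>e i'\<close> has length
    \<open>c + 1\<close>. The new path skips the first \<open>c\<close> arcs, runs up to
    \<open>e (i' - 1)\<close> and jumps to \<open>e i\<close>, which is legitimate since
    \<open>e i = e i'\<close>. The net delay is exactly one.\<close>
  define c where "c = i' - i - 1"
  have c: "Suc (i + c) = i'" using i by (simp add: c_def)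
  define e' where "e' n = (if n \<le> i then e (n + c) else e (n - 1))" for n
  have "head G (e' n) = tail G (e' (Suc n))" for n
  proof (cases "n = i")
    case True
    thus ?thesis using e(2)[of "i + c"] c i by (simp add: e'_def)
  next
    case False
    thus ?thesis using e(2)[of "n + c"] e(2)[of "n - 1"] by (auto simp: e'_def)
  qed
  moreover have "e' n \<in> arcs G" for n using e(1) by (simp add: e'_def)
  ultimately have "(\<lambda>n. lab (e' n)) \<in> path_labels G lab"
    unfolding path_labels_def by blast
  moreover have "lab (e' (Suc n)) = z n" if "i \<le> n" for n using that by (simp add: e(3) e'_def)
  ultimately show ?thesis by (intro bexI[of _ "\<lambda>n. lab (e' n)"] exI[of _ i]) auto
qed

lemma path_labels_delay:
  assumes "fin_digraph G" "z \<in> path_labels G lab"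
  shows "\<exists>y\<in>path_labels G lab. \<exists>i. \<forall>n\<ge>i. y (n + k) = z n"
proof (induction k)
  case 0 show ?case using assms(2) by auto
next
  case (Suc k)
  then obtain y i where y: "y \<in> path_labels G lab" "\<forall>n\<ge>i. y (n + k) = z n" by blast
  obtain y' i' where y': "y' \<in> path_labels G lab" "\<forall>n\<ge>i'. y' (Suc n) = y n"
    using path_labels_delay1[OF assms(1) y(1)] by blast
  have "\<forall>n\<ge>max i i'. y' (n + Suc k) = z n" using y y' by simp
  with y' show ?case by blast
qed

lemma radic_shift_funpow: "(radic_shift ^^ k) x = (\<lambda>i. x (i + k))"
  by (induction k) (auto simp: radic_shift_def)

text \<open>The tail of \<open>u\<close> lies in \<open>X\<close> at positions moved by
  \<open>k\<close>; delaying its path by \<open>k\<close> steps puts the digits back in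
  place.\<close>

lemma sofic_has_tail_finite_change:
  assumes "sofic_shift r X" "has_tail_in u X"
  obtains y K where "y \<in> X" "\<forall>n\<ge>K. y n = u n"
proof -
  obtain G :: "(nat, nat) pre_digraph" and lab where G: "fin_digraph G" "X = path_labels G lab"
    using assms(1) by (auto simp: sofic_shift_def)
  obtain k where k: "(\<lambda>i. u (i + k)) \<in> X"
    using assms(2) by (auto simp: has_tail_in_def radic_shift_funpow)
  obtain y i where y: "y \<in> X" "\<forall>n\<ge>i. y (n + k) = u (n + k)"
    using path_labels_delay[OF G(1)] k G(2) by metis
  have "y n = u n" if "n \<ge> i + k" for n
    using y(2)[rule_format, of "n - k"] that by simp
  with y(1) that show thesis by blast
qed

section \<open>Truncations modulo powers of \<open>r\<close> and translates of points of
  \<open>X\<close>\<close>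

lemma radic_trunc_split:
  "radic_trunc r x (m + n) = radic_trunc r x m + r ^ m * radic_trunc r (\<lambda>i. x (i + m)) n"
proof (induction n)
  case 0 show ?case by (simp add: radic_trunc_def)
next
  case (Suc n)
  thus ?case by (simp add: radic_trunc_Suc algebra_simps power_add)
qed

lemma radic_trunc_eqD:
  assumes "x \<in> radic_carrier r" "y \<in> radic_carrier r" "radic_trunc r x n = radic_trunc r y n" "i < n"
  shows "x i = y i"
  using radic_trunc_mod[OF assms(1), of "Suc i" n] radic_trunc_mod[OF assms(2), of "Suc i" n]
    radic_digit[OF assms(1), of i] radic_digit[OF assms(2), of i] assms(3,4) by simp

lemma radic_trunc_cong:
  assumes "x \<in> radic_carrier r" "n \<le> m"
  shows "[int (radic_trunc r x m) = int (radic_trunc r x n)] (mod int r ^ n)"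
  using radic_trunc_mod[OF assms] radic_trunc_mod[OF assms(1) order_refl, of n]
  by (metis cong_def cong_int_iff of_nat_power)

lemma radic_trunc_add_cong:
  assumes "0 < r"
  shows "[int (radic_trunc r (radic_add r x y) n)
        = int (radic_trunc r x n) + int (radic_trunc r y n)] (mod int r ^ n)"
  using radic_trunc_add[OF assms, of x y n] by (simp add: cong_def zmod_int)

text \<open>Beyond \<open>K\<close> the two truncations grow by the same amounts, so their
  difference is a fixed integer; a smaller \<open>n\<close> inherits the congruence from a larger
  one.\<close>

lemma radic_finite_change_cong:
  assumes "x \<in> radic_carrier r" "y \<in> radic_carrier r" "\<forall>n\<ge>K. y n = x n"
  shows "\<exists>d. \<forall>n. [int (radic_trunc r y n) = int (radic_trunc r x n) + d] (mod int r ^ n)"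
proof -
  define d where "d = int (radic_trunc r y K) - int (radic_trunc r x K)"
  have eq: "int (radic_trunc r y n) = int (radic_trunc r x n) + d" if "K \<le> n" for n
    using that
  proof (induction n rule: dec_induct)
    case base show ?case by (simp add: d_def)
  next
    case (step n) thus ?case using assms(3) by (simp add: radic_trunc_Suc)
  qed
  have "[int (radic_trunc r y n) = int (radic_trunc r x n) + d] (mod int r ^ n)" for n
  proof -
    define m where "m = max K n"
    have "[int (radic_trunc r y n) = int (radic_trunc r y m)] (mod int r ^ n)"
      by (intro cong_sym[OF radic_trunc_cong[OF assms(2)]]) (simp add: m_def)
    also have "int (radic_trunc r y m) = int (radic_trunc r x m) + d" by (simp add: eq m_def)
    also have "[int (radic_trunc r x m) + d = int (radic_trunc r x n) + d] (mod int r ^ n)"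
      using radic_trunc_cong[OF assms(1), of n m] by (intro cong_add) (simp_all add: m_def)
    finally show ?thesis .
  qed
  thus ?thesis by blast
qed

text \<open>Each addition of \<open>t\<close> is followed by a finite change of digits that returns
  to \<open>X\<close>, at the cost of an integer. The total correction \<open>d\<close> depends on
  \<open>m\<close> but not on \<open>n\<close>, so it becomes negligible against
  \<open>r ^ n\<close>.\<close>

lemma sofic_tail_translate:
  assumes "0 < r" "sofic_shift r X" "\<forall>x\<in>X. has_tail_in (radic_add r x t) X" "x \<in> X"
  shows "\<exists>y\<in>X. \<exists>d. \<forall>n. [int (radic_trunc r y n)
           = int (radic_trunc r x n) + int m * int (radic_trunc r t n) + d] (mod int r ^ n)"
proof (induction m)
  case 0
  show ?case by (rule bexI[OF _ assms(4)], rule exI[of _ 0]) simp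
next
  case (Suc m)
  then obtain y d where y: "y \<in> X" "\<And>n. [int (radic_trunc r y n)
      = int (radic_trunc r x n) + int m * int (radic_trunc r t n) + d] (mod int r ^ n)" by blast
  obtain z K where z: "z \<in> X" "\<forall>n\<ge>K. z n = radic_add r y t n"
    using sofic_has_tail_finite_change[OF assms(2)] assms(3) y(1) by metis
  obtain d' where d': "\<And>n. [int (radic_trunc r z n)
      = int (radic_trunc r (radic_add r y t) n) + d'] (mod int r ^ n)"
    using radic_finite_change_cong[OF radic_add_closed[OF assms(1)] _ z(2)] z(1)
      sofic_shift_subset[OF assms(2)] by blast
  have "[int (radic_trunc r z n)
      = int (radic_trunc r x n) + int (Suc m) * int (radic_trunc r t n) + (d + d')] (mod int r ^ n)" for n
  proof -
    have "[int (radic_trunc r z n)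
        = int (radic_trunc r y n) + int (radic_trunc r t n) + d'] (mod int r ^ n)"
      using d' radic_trunc_add_cong[OF assms(1)] by (meson cong_add_rcancel cong_trans)
    also have "[int (radic_trunc r y n) + int (radic_trunc r t n) + d'
        = (int (radic_trunc r x n) + int m * int (radic_trunc r t n) + d)
          + int (radic_trunc r t n) + d'] (mod int r ^ n)"
      using y(2) by (intro cong_add) auto
    finally show ?thesis by (simp add: algebra_simps)
  qed
  with z(1) show ?case by blast
qed

text \<open>Division by \<open>r ^ m\<close> strips the low digits, so occurrence of
  \<open>w\<close> at position \<open>m\<close> becomes membership of a truncation in an interval of
  length \<open>r ^ m\<close>.\<close>

lemma word_in_language:
  assumes "x \<in> X" "X \<subseteq> radic_carrier r" "w \<in> lists {..<r}"
    and "radic_trunc r x (m + length w) div r ^ m = radic_trunc r (\<lambda>i. if i < length w then w ! i else 0) (length w)"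
  shows "w \<in> language X"
proof -
  define v where "v = (\<lambda>i. if i < length w then w ! i else 0)"
  have x: "x \<in> radic_carrier r" using assms by blast
  hence r: "0 < r" by (auto simp: radic_carrier_def)
  have v: "v \<in> radic_carrier r" using assms(3) r by (force simp: v_def radic_carrier_def in_lists_conv_set)
  have s: "(\<lambda>i. x (i + m)) \<in> radic_carrier r" using x by (simp add: radic_carrier_def)
  have "radic_trunc r (\<lambda>i. x (i + m)) (length w) = radic_trunc r v (length w)"
    using assms(4) radic_trunc_less[OF x, of m] r by (simp add: radic_trunc_split v_def)
  hence "w ! i = x (i + m)" if "i < length w" for i
    using radic_trunc_eqD[OF s v _ that] that by (simp add: v_def)
  hence "w = map x [m..<m + length w]"
    by (intro nth_equalityI) (auto simp: add.commute)
  with assms(1) show ?thesis unfolding language_def by blast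
qed

section \<open>Dirichlet approximation and arithmetic progressions on a finite circle\<close>

text \<open>
  The end point \<open>N\<close> is used as an additional multiple of \<open>a\<close> modulo \<open>N\<close>; without it the
  pigeonhole principle only gives \<open>\<bar>s\<bar> < N / Q\<close>.
\<close>

lemma Dirichlet_approx_mod:
  fixes N a :: int
  assumes "0 < N" "0 < Q"
  obtains q s where "0 < q" "q \<le> Q" "[s = int q * a] (mod N)" "(int Q + 1) * \<bar>s\<bar> \<le> N"
proof -
  define v where "v k = (if k \<le> Q then (int k * a) mod N else N)" for k
  \<comment> \<open>\<open>b k\<close> is the number of the box of width \<open>N / (Q + 1)\<close>
    containing \<open>v k\<close>; the end point \<open>N\<close> is put into the last box,
    \<open>Q\<close>. This gives \<open>Q + 2\<close> indices for \<open>Q + 1\<close>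
    boxes.\<close>
  define b where "b k = (if k \<le> Q then (v k * (int Q + 1)) div N else int Q)" for k
  have v: "0 \<le> v k" "v k \<le> N" "k \<le> Q \<Longrightarrow> v k < N" for k
    using assms pos_mod_bound[of N "int k * a"] by (auto simp: v_def intro: less_imp_le)
  have lo: "b k * N \<le> v k * (int Q + 1)" for k
  proof (cases "k \<le> Q")
    case True
    have "(v k * (int Q + 1)) div N * N \<le> v k * (int Q + 1)"
      using assms(1) by (simp add: minus_mod_eq_div_mult [symmetric])
    thus ?thesis using True by (simp add: b_def)
  next
    case False thus ?thesis using assms by (simp add: b_def v_def algebra_simps)
  qed
  have hi: "v k * (int Q + 1) \<le> b k * N + N" for k
  proof (cases "k \<le> Q")
    case True
    have "v k * (int Q + 1) < ((v k * (int Q + 1)) div N + 1) * N"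
      using pos_mod_bound[OF assms(1), of "v k * (int Q + 1)"]
        div_mult_mod_eq[of "v k * (int Q + 1)" N] unfolding distrib_right[of _ 1 N] by linarith
    thus ?thesis using True by (simp add: b_def algebra_simps)
  next
    case False thus ?thesis using assms by (simp add: b_def v_def algebra_simps)
  qed
  have "b k \<in> {0..int Q}" for k
  proof (cases "k \<le> Q")
    case True
    have "b k * N \<le> v k * (int Q + 1)" by (rule lo)
    also have "\<dots> < N * (int Q + 1)" using v(3)[OF True] by (intro mult_strict_right_mono) auto
    finally have "b k * N < (int Q + 1) * N" by (simp only: mult.commute)
    hence "b k < int Q + 1" using assms by simp
    moreover have "0 \<le> b k" using v assms True by (simp add: b_def div_int_pos_iff)
    ultimately show ?thesis by simp
  next
    case False thus ?thesis by (simp add: b_def)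
  qed
  hence "b ` {0..Suc Q} \<subseteq> {0..int Q}" by blast
  hence "card (b ` {0..Suc Q}) \<le> card {0..int Q}" by (rule card_mono[rotated]) simp
  hence "card (b ` {0..Suc Q}) < card {0..Suc Q}" by simp
  hence "\<not> inj_on b {0..Suc Q}" by (rule pigeonhole)
  then obtain i k where ik: "i < k" "k \<le> Suc Q" "b i = b k"
    by (metis atLeastAtMost_iff linorder_inj_onI')
  define s where "s = v k - v i"
  have "(int Q + 1) * s \<le> N" "- ((int Q + 1) * s) \<le> N"
    using lo[of k] hi[of k] lo[of i] hi[of i] ik(3) by (auto simp: s_def algebra_simps)
  hence s: "(int Q + 1) * \<bar>s\<bar> \<le> N" by (cases "s \<ge> 0") auto
  show thesis
  proof (cases "k \<le> Q")
    case True
    have "[s = int k * a - int i * a] (mod N)"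
      using True ik unfolding s_def v_def by (auto simp: cong_def mod_diff_eq)
    hence "[s = int (k - i) * a] (mod N)" using ik by (simp add: of_nat_diff algebra_simps)
    thus thesis using that[of "k - i" s] True ik s by simp
  next
    case False
    \<comment> \<open>The multiple 0 and the end point \<open>N\<close> are the same point of the
      circle, but they lie in different boxes as \<open>0 < Q\<close>. Hence a collision with the
      end point still yields a positive multiplier.\<close>
    have "b 0 \<noteq> int Q" using assms by (simp add: b_def v_def)
    hence "0 < i" using ik False by (cases "i = 0") (auto simp: b_def)
    have "[- s = int i * a] (mod N)"
      using False ik unfolding s_def v_def by (auto simp: cong_def mod_diff_eq)
    thus thesis using that[of i "- s"] False ik s \<open>0 < i\<close> by simp
  qed
qed

text \<open>A progression cannot jump over a window as long as its step, and it reaches the window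
  within two turns around the circle.\<close>

lemma arith_progression_hits_pos:
  fixes N s x B :: int
  assumes "0 < s" "N \<le> int K * s" "0 \<le> B" "B < N"
  shows "\<exists>k\<le>2 * K + 1. \<exists>z. B \<le> x + int k * s + z * N \<and> x + int k * s + z * N < B + s"
proof -
  define x' where "x' = x mod N"
  \<comment> \<open>Aiming at \<open>B + N\<close> rather than \<open>B\<close> makes the distance
    positive; \<open>k\<close> below is \<open>c / s\<close> rounded up.\<close>
  define c where "c = B + N - x'"
  have x': "0 \<le> x'" "x' < N" "x' = x - x div N * N"
    using assms by (auto simp: x'_def minus_div_mult_eq_mod)
  define k where "k = (c + s - 1) div s"
  have c: "0 < c" "c \<le> 2 * N" using x' assms by (auto simp: c_def)
  have k1: "k * s \<le> c + s - 1"
    using pos_mod_sign[OF assms(1), of "c + s - 1"]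
    by (simp only: k_def minus_mod_eq_div_mult [symmetric])
  have k2: "c \<le> k * s"
  proof -
    have "c + s - 1 = k * s + (c + s - 1) mod s" by (simp add: k_def)
    moreover have "(c + s - 1) mod s \<le> s - 1" using assms(1) by (simp add: zle_diff1_eq)
    ultimately show ?thesis by linarith
  qed
  have k0: "0 \<le> k" using assms c by (simp add: k_def div_int_pos_iff)
  have "k * s < (2 * int K + 2) * s" using k1 c(2) assms(1,2) by (simp add: algebra_simps)
  hence "k < 2 * int K + 2" using assms(1) by simp
  hence "nat k \<le> 2 * K + 1" using k0 by simp
  moreover have "B \<le> x + int (nat k) * s + (- (x div N) - 1) * N
      \<and> x + int (nat k) * s + (- (x div N) - 1) * N < B + s"
    using k0 k1 k2 x'(3) unfolding c_def by (simp add: algebra_simps)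
  ultimately show ?thesis by blast
qed

text \<open>A negative step is made positive by reading the progression backwards from its term of
  index \<open>2 * K + 1\<close>.\<close>

lemma arith_progression_hits:
  fixes N s x B L :: int
  assumes "N \<le> int K * \<bar>s\<bar>" "\<bar>s\<bar> \<le> L" "0 \<le> B" "B < N"
  shows "\<exists>k\<le>2 * K + 1. \<exists>z. B \<le> x + int k * s + z * N \<and> x + int k * s + z * N < B + L"
proof (cases "0 < s")
  case True
  thus ?thesis using arith_progression_hits_pos[of s N K B x] assms by fastforce
next
  case False
  define T where "T = 2 * K + 1"
  have "s \<noteq> 0" using assms by auto
  then obtain k z where kz: "k \<le> T" "B \<le> (x + int T * s) + int k * (- s) + z * N"
    "(x + int T * s) + int k * (- s) + z * N < B + (- s)"
    using arith_progression_hits_pos[of "- s" N K B "x + int T * s"] assms False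
    unfolding T_def by auto
  have "(x + int T * s) + int k * (- s) = x + int (T - k) * s"
    using kz(1) by (simp add: of_nat_diff algebra_simps)
  hence "B \<le> x + int (T - k) * s + z * N \<and> x + int (T - k) * s + z * N < B + L"
    using kz assms(2) False by auto
  moreover have "T - k \<le> 2 * K + 1" by (simp add: T_def)
  ultimately show ?thesis by blast
qed

section \<open>Multiples of \<open>t\<close> with bounded multiplier and small residue\<close>

text \<open>
  If \<open>\<bar>s\<bar>\<close> were at least \<open>r ^ n / K\<close>, boundedly many multiples of \<open>q t\<close> would run around
  the circle of integers modulo \<open>r ^ n\<close> in steps shorter than the cylinder of \<open>w\<close>.
\<close>

lemma sofic_translate_approx:
  assumes "2 \<le> r" "sofic_shift r X" "w \<in> lists {..<r}" "w \<notin> language X"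
    and "\<forall>x\<in>X. has_tail_in (radic_add r x t) X"
  shows "\<exists>n0. \<forall>n\<ge>n0. \<exists>q s. 0 < q \<and> q \<le> r ^ length w
           \<and> [s = int q * int (radic_trunc r t n)] (mod int r ^ n) \<and> int K * \<bar>s\<bar> < int r ^ n"
proof -
  define j where "j = length w"
  define Q where "Q = r ^ j"
  define T where "T = (2 * K + 1) * Q"
  define v where "v = (\<lambda>i. if i < length w then w ! i else 0)"
  define W where "W = radic_trunc r v j"
  have r: "0 < r" using assms by simp
  have "v \<in> radic_carrier r"
    using assms(3) r by (force simp: v_def radic_carrier_def in_lists_conv_set)
  hence W: "W < Q" unfolding W_def Q_def by (rule radic_trunc_less)
  have Q: "0 < Q" using r by (simp add: Q_def)
  obtain x where x: "x \<in> X" using assms(2) by (auto simp: sofic_shift_def)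
  obtain y d where y: "\<And>m. y m \<in> X" "\<And>m n. [int (radic_trunc r (y m) n)
        = int (radic_trunc r x n) + int m * int (radic_trunc r t n) + d m] (mod int r ^ n)"
    using sofic_tail_translate[OF r assms(2,5) x] by metis
  \<comment> \<open>Only multiples \<open>k * q\<close> with \<open>k \<le> 2 * K + 1\<close> and
    \<open>q \<le> Q\<close> will occur, so \<open>D\<close> bounds all their integer corrections
    before \<open>n\<close> is chosen.\<close>
  define D where "D = (\<Sum>m\<le>T. \<bar>d m\<bar>)"
  have D: "\<bar>d m\<bar> \<le> D" if "m \<le> T" for m
    unfolding D_def using that by (intro member_le_sum) auto
  have D0: "0 \<le> D" using D[of 0] by simp
  \<comment> \<open>With \<open>m \<ge> n1\<close> the cylinder width \<open>R = r ^ m\<close>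
    exceeds \<open>2 * D * (Q + 1)\<close>.\<close>
  define n1 where "n1 = nat (2 * D * (int Q + 1))"
  have "\<exists>q s. 0 < q \<and> q \<le> Q \<and> [s = int q * int (radic_trunc r t n)] (mod int r ^ n)
          \<and> int K * \<bar>s\<bar> < int r ^ n" if n: "n \<ge> n1 + j" for n
  proof -
    define m where "m = n - j"
    define N where "N = int r ^ n"
    define R where "R = int r ^ m"
    have nm: "n = m + j" "n1 \<le> m" using n by (auto simp: m_def)
    have N: "N = int Q * R" by (simp add: N_def R_def nm Q_def power_add mult.commute)
    have R0: "0 < R" and N0: "0 < N" using r by (auto simp: R_def N_def)
    have "m < r ^ m" using assms(1) by (intro power_gt_expt) simp
    hence "int m < R" unfolding R_def by (metis of_nat_less_iff of_nat_power)
    hence R: "2 * D * (int Q + 1) < R" using nm(2) D0 by (simp add: n1_def)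
    obtain q s where q: "0 < q" "q \<le> Q" and s: "[s = int q * int (radic_trunc r t n)] (mod N)"
      and s_le: "(int Q + 1) * \<bar>s\<bar> \<le> N"
      using Dirichlet_approx_mod[OF N0 Q] by metis
    have "int K * \<bar>s\<bar> < N"
    proof (rule ccontr)
      assume big: "\<not> int K * \<bar>s\<bar> < N"
      \<comment> \<open>Since \<open>N = Q * R\<close>, the factor \<open>Q + 1\<close> in the
        Dirichlet bound leaves a gap of \<open>R / (Q + 1)\<close> between the step and the cylinder
        width, and this gap absorbs \<open>2 * D\<close>.\<close>
      have "(int Q + 1) * \<bar>s\<bar> \<le> (int Q + 1) * (R - 2 * D)"
        using s_le R unfolding N by (simp add: algebra_simps)
      hence L: "\<bar>s\<bar> \<le> R - 2 * D" using Q by simp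
      have "2 * D * 1 \<le> 2 * D * (int Q + 1)" using D0 by (intro mult_left_mono) auto
      hence DR: "2 * D < R" using R by simp
      have "(int W + 1) * R \<le> int Q * R" using W R0 by (intro mult_right_mono) auto
      hence WN: "int W * R + R \<le> N" unfolding N by (simp add: algebra_simps)
      \<comment> \<open>The target is the cylinder of \<open>w\<close> shrunk by \<open>D\<close> at
        both ends, so that adding the correction \<open>d (k * q)\<close> cannot leave the
        cylinder.\<close>
      obtain k z where k: "k \<le> 2 * K + 1"
        and kz: "int W * R + D \<le> int (radic_trunc r x n) + int k * s + z * N"
          "int (radic_trunc r x n) + int k * s + z * N < int W * R + D + (R - 2 * D)"
        using arith_progression_hits[of N K s "R - 2 * D" "int W * R + D" "int (radic_trunc r x n)"]
          big L D0 R0 DR WN by auto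
      have "k * q \<le> T" unfolding T_def using k q by (intro mult_le_mono) auto
      note d = D[OF this]
      define u where "u = int (radic_trunc r x n) + int k * s + z * N + d (k * q)"
      have u: "int W * R \<le> u" "u < int W * R + R" using kz d by (auto simp: u_def)
      have "0 \<le> int W * R" using R0 by simp
      hence u0: "0 \<le> u" "u < N" using u WN by linarith+
      have "[int (radic_trunc r (y (k * q)) n) = int (radic_trunc r x n)
          + int (k * q) * int (radic_trunc r t n) + d (k * q)] (mod N)"
        unfolding N_def by (rule y(2))
      also have "[int (radic_trunc r x n) + int (k * q) * int (radic_trunc r t n) + d (k * q)
          = int (radic_trunc r x n) + int k * s + d (k * q)] (mod N)"
        using cong_scalar_left[OF s, of "int k"]
        by (intro cong_add) (auto simp: mult.assoc intro: cong_sym)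
      also have "[int (radic_trunc r x n) + int k * s + d (k * q) = u] (mod N)"
        by (simp add: u_def cong_iff_lin)
      finally have "int (radic_trunc r (y (k * q)) n) mod N = u"
        using u0 by (simp add: cong_def)
      moreover have "int (radic_trunc r (y (k * q)) n) < N"
        using radic_trunc_less[of "y (k * q)" r n] y(1) sofic_shift_subset[OF assms(2)]
        by (auto simp: N_def simp flip: of_nat_power)
      ultimately have "int (radic_trunc r (y (k * q)) n) = u" by simp
      moreover have "u div R = int W"
        using u by (intro int_div_pos_eq[where r = "u - int W * R"]) auto
      ultimately have "int (radic_trunc r (y (k * q)) n div r ^ m) = int W"
        by (simp add: R_def zdiv_int)
      hence "radic_trunc r (y (k * q)) (m + length w) div r ^ m = radic_trunc r v (length w)"
        by (simp add: W_def nm(1) j_def)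
      hence "w \<in> language X"
        using word_in_language[OF y(1) sofic_shift_subset[OF assms(2)] assms(3)] unfolding v_def by blast
      with assms(4) show False by blast
    qed
    thus ?thesis using q s by (auto simp: N_def)
  qed
  thus ?thesis unfolding Q_def j_def by blast
qed

section \<open>Integer multiples of \<open>t\<close>\<close>

lemma radic_trunc_nmult_cong:
  assumes "0 < r"
  shows "[int (radic_trunc r (radic_nmult r q t) n) = int q * int (radic_trunc r t n)] (mod int r ^ n)"
proof (induction q)
  case 0 show ?case by (simp add: radic_nmult_def radic_trunc_def)
next
  case (Suc q)
  have "[int (radic_trunc r (radic_nmult r (Suc q) t) n)
      = int (radic_trunc r t n) + int (radic_trunc r (radic_nmult r q t) n)] (mod int r ^ n)"
    using radic_trunc_add_cong[OF assms] by (simp add: radic_nmult_def)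
  also have "[int (radic_trunc r t n) + int (radic_trunc r (radic_nmult r q t) n)
      = int (radic_trunc r t n) + int q * int (radic_trunc r t n)] (mod int r ^ n)"
    using Suc by (intro cong_add) auto
  finally show ?case by (simp add: algebra_simps)
qed

lemma radic_nmult_closed: "0 < r \<Longrightarrow> radic_nmult r q t \<in> radic_carrier r"
  by (cases q) (simp_all add: radic_nmult_def radic_add_closed, simp add: radic_carrier_def)

lemma radic_nmult_IntsI:
  assumes "0 < r" "\<forall>n. [int q * int (radic_trunc r t n) = a] (mod int r ^ n)"
  shows "radic_nmult r q t \<in> radic_Ints r"
proof -
  have "radic_nmult r q t = radic_of_int r a"
  proof (rule radic_eqI)
    fix n
    have "[int (radic_trunc r (radic_nmult r q t) n) = a] (mod int r ^ n)"
      using radic_trunc_nmult_cong[OF assms(1)] assms(2) by (meson cong_trans)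
    moreover have "int (radic_trunc r (radic_nmult r q t) n) < int r ^ n"
      using radic_trunc_less[OF radic_nmult_closed[OF assms(1)]] by (simp flip: of_nat_power)
    ultimately have "int (radic_trunc r (radic_nmult r q t) n) = a mod int r ^ n"
      by (simp add: cong_def)
    thus "radic_trunc r (radic_nmult r q t) n = radic_trunc r (radic_of_int r a) n"
      using radic_trunc_of_int[OF assms(1), of a n] by simp
  qed (use assms in \<open>auto intro: radic_nmult_closed radic_of_int_closed\<close>)
  thus ?thesis by (simp add: radic_Ints_def)
qed

lemma cong_int_eqI:
  fixes a b N :: int
  assumes "[a = b] (mod N)" "\<bar>a\<bar> + \<bar>b\<bar> < N"
  shows "a = b"
proof (rule ccontr)
  assume "a \<noteq> b"
  hence "N \<le> \<bar>a - b\<bar>"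
    using assms dvd_imp_le_int[of "a - b" N] by (auto simp: cong_iff_dvd_diff)
  with assms(2) show False by linarith
qed

text \<open>Consecutive representatives agree modulo \<open>r ^ n\<close>, and
  \<open>r ^ Suc n / (r + 1) + r ^ n / (r + 1) = r ^ n\<close> bounds the sum of their absolute
  values, so they are equal. The sequence is thus eventually constant.\<close>

lemma radic_integer_multiple_if_small:
  assumes "0 < r" "t \<in> radic_carrier r"
    and "\<And>n. n \<ge> n0 \<Longrightarrow> \<exists>b. [b = int P * int (radic_trunc r t n)] (mod int r ^ n)
                  \<and> (int r + 1) * \<bar>b\<bar> < int r ^ n"
  shows "\<exists>a. \<forall>n. [int P * int (radic_trunc r t n) = a] (mod int r ^ n)"
proof -
  obtain b where b: "\<And>n. n \<ge> n0 \<Longrightarrow> [b n = int P * int (radic_trunc r t n)] (mod int r ^ n)"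
      "\<And>n. n \<ge> n0 \<Longrightarrow> (int r + 1) * \<bar>b n\<bar> < int r ^ n"
    using assms(3) by metis
  have step: "b (Suc n) = b n" if "n \<ge> n0" for n
  proof (rule cong_int_eqI)
    have "[b (Suc n) = int P * int (radic_trunc r t (Suc n))] (mod int r ^ n)"
      using b(1)[of "Suc n"] that
      by (intro cong_dvd_modulus[of _ _ "int r ^ Suc n" "int r ^ n"]) auto
    also have "[int P * int (radic_trunc r t (Suc n)) = int P * int (radic_trunc r t n)] (mod int r ^ n)"
      by (intro cong_scalar_left radic_trunc_cong[OF assms(2)]) simp
    also have "[int P * int (radic_trunc r t n) = b n] (mod int r ^ n)"
      using b(1)[OF that] by (rule cong_sym)
    finally show "[b (Suc n) = b n] (mod int r ^ n)" .
    have "(int r + 1) * (\<bar>b (Suc n)\<bar> + \<bar>b n\<bar>) < (int r + 1) * int r ^ n"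
      using b(2)[of "Suc n"] b(2)[of n] that by (simp add: algebra_simps)
    thus "\<bar>b (Suc n)\<bar> + \<bar>b n\<bar> < int r ^ n" by (simp add: mult_less_cancel_left)
  qed
  have const: "b n = b n0" if "n \<ge> n0" for n
    using that by (induction n rule: dec_induct) (auto simp: step)
  have "[int P * int (radic_trunc r t n) = b n0] (mod int r ^ n)" for n
  proof -
    define m where "m = max n0 n"
    have "[int P * int (radic_trunc r t n) = int P * int (radic_trunc r t m)] (mod int r ^ n)"
      by (intro cong_scalar_left cong_sym[OF radic_trunc_cong[OF assms(2)]]) (simp add: m_def)
    also have "[int P * int (radic_trunc r t m) = b m] (mod int r ^ n)"
      by (rule cong_sym, rule cong_dvd_modulus[OF b(1)]) (auto simp: m_def le_imp_power_dvd)
    finally show ?thesis using const[of m] by (simp add: m_def)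
  qed
  thus ?thesis by blast
qed

text \<open>Absence of torsion in congruences: the lowest digit shows that \<open>gcd q r\<close>
  divides \<open>a\<close>, and cancelling it modulo \<open>r ^ Suc n\<close> still leaves a
  multiple of \<open>r ^ n\<close> as modulus.\<close>

lemma radic_integer_multiple_div_gcd:
  assumes "0 < r" "t \<in> radic_carrier r"
    and "\<forall>n. [int q * int (radic_trunc r t n) = a] (mod int r ^ n)"
  shows "\<exists>a'. \<forall>n. [int (q div gcd q r) * int (radic_trunc r t n) = a'] (mod int r ^ n)"
proof -
  define g where "g = gcd q r"
  define q' where "q' = q div g"
  define r' where "r' = r div g"
  have q: "q = g * q'" and r: "r = g * r'" by (auto simp: q'_def r'_def g_def)
  have g: "0 < g" using assms(1) by (simp add: g_def)
  have "[int q * int (radic_trunc r t 1) = a] (mod int r)" using assms(3)[rule_format, of 1] by simp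
  hence "[int q * int (radic_trunc r t 1) = a] (mod int g)"
    by (rule cong_dvd_modulus) (simp add: g_def)
  moreover have "int g dvd int q * int (radic_trunc r t 1)" by (simp add: q)
  ultimately have "int g dvd a" by (simp add: cong_dvd_iff)
  then obtain a' where a': "a = int g * a'" by blast
  have "[int q' * int (radic_trunc r t n) = a'] (mod int r ^ n)" for n
  proof -
    have "[int q * int (radic_trunc r t (Suc n)) = a] (mod int r ^ Suc n)" using assms(3) by blast
    hence "int g * (int r' * int r ^ n) dvd int g * (int q' * int (radic_trunc r t (Suc n)) - a')"
      by (subst (asm) (1) q) (simp add: cong_iff_dvd_diff a' r algebra_simps)
    hence "int r' * int r ^ n dvd int q' * int (radic_trunc r t (Suc n)) - a'" using g by simp
    hence "[int q' * int (radic_trunc r t (Suc n)) = a'] (mod int r ^ n)"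
      by (simp add: cong_iff_dvd_diff dvd_mult_right)
    moreover have "[int q' * int (radic_trunc r t (Suc n)) = int q' * int (radic_trunc r t n)] (mod int r ^ n)"
      by (intro cong_scalar_left radic_trunc_cong[OF assms(2)]) simp
    ultimately show ?thesis by (meson cong_sym cong_trans)
  qed
  thus ?thesis unfolding q'_def g_def by blast
qed

section \<open>The least multiplier that makes \<open>t\<close> an integer\<close>

theorem lemma3p14:
  fixes r j :: nat and X :: "(nat \<Rightarrow> nat) set" and w :: "nat list" and t :: "nat \<Rightarrow> nat"
  assumes "r \<ge> 2"
    and "proper_sofic_shift r X"
    and "w \<in> lists {..<r}" and "length w = j" and "w \<notin> language X"
    and "t \<in> radic_carrier r"
    and "\<forall>x\<in>X. has_tail_in (radic_add r x t) X"
  shows "\<exists>n>0. radic_nmult r n t \<in> radic_Ints r \<and> coprime n r \<and> n \<le> r ^ j - 1"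
proof -
  have X: "sofic_shift r X" using assms(2) by (simp add: proper_sofic_shift_def)
  have r: "0 < r" using assms(1) by simp
  define Q where "Q = r ^ j"
  define tr where "tr n = int (radic_trunc r t n)" for n
  define integral where "integral q \<longleftrightarrow> 0 < q \<and> (\<exists>a. \<forall>n. [int q * tr n = a] (mod int r ^ n))" for q
  have approx: "\<exists>n0. \<forall>n\<ge>n0. \<exists>q s. 0 < q \<and> q \<le> Q
      \<and> [s = int q * tr n] (mod int r ^ n) \<and> int K * \<bar>s\<bar> < int r ^ n" for K
    using sofic_translate_approx[OF assms(1) X assms(3,5,7), of K]
    unfolding Q_def assms(4) tr_def .
  \<comment> \<open>The multiplier \<open>q\<close> varies with \<open>n\<close>; the factorial is a
    common multiple of all candidates.\<close>
  define P :: nat where "P = fact Q"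
  have "integral P"
  proof -
    \<comment> \<open>Passing from \<open>q\<close> to \<open>P\<close> scales \<open>s\<close> by
      at most \<open>P\<close>; the factor \<open>r + 1\<close> is the smallness needed for
      constancy of the residues.\<close>
    obtain n0 where n0: "\<And>n. n \<ge> n0 \<Longrightarrow> \<exists>q s. 0 < q \<and> q \<le> Q
        \<and> [s = int q * tr n] (mod int r ^ n) \<and> int (P * (r + 1)) * \<bar>s\<bar> < int r ^ n"
      using approx[of "P * (r + 1)"] by blast
    have "\<exists>b. [b = int P * tr n] (mod int r ^ n) \<and> (int r + 1) * \<bar>b\<bar> < int r ^ n"
      if n: "n \<ge> n0" for n
    proof -
      obtain q s where q: "0 < q" "q \<le> Q" and s: "[s = int q * tr n] (mod int r ^ n)"
        "int (P * (r + 1)) * \<bar>s\<bar> < int r ^ n" using n0[OF n] by blast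
      have "q dvd P" unfolding P_def using q by (intro dvd_fact) auto
      then obtain c where c: "P = q * c" by blast
      have "[int c * s = int P * tr n] (mod int r ^ n)"
        using cong_scalar_left[OF s(1), of "int c"] by (simp add: c mult_ac)
      moreover have "c \<le> P" using q by (simp add: c)
      hence "int c * ((int r + 1) * \<bar>s\<bar>) \<le> int P * ((int r + 1) * \<bar>s\<bar>)"
        by (intro mult_right_mono) auto
      hence "(int r + 1) * \<bar>int c * s\<bar> < int r ^ n"
        using s(2) by (simp add: abs_mult algebra_simps)
      ultimately show ?thesis by blast
    qed
    hence "\<exists>a. \<forall>n. [int P * tr n = a] (mod int r ^ n)"
      using radic_integer_multiple_if_small[OF r assms(6), of n0 P] unfolding tr_def by blast
    thus ?thesis by (simp add: integral_def P_def)
  qed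
  define q0 where "q0 = (LEAST q. integral q)"
  have q0: "integral q0" unfolding q0_def using \<open>integral P\<close> by (rule LeastI)
  have least: "q0 \<le> q" if "integral q" for q unfolding q0_def using that by (rule Least_le)
  from q0 obtain a where q0_pos: "0 < q0" and a: "\<And>n. [int q0 * tr n = a] (mod int r ^ n)"
    by (auto simp: integral_def)
  \<comment> \<open>A common factor with \<open>r\<close> could be divided out, against
    minimality.\<close>
  have "integral (q0 div gcd q0 r)"
    using radic_integer_multiple_div_gcd[OF r assms(6), of q0 a] a q0_pos
    by (simp add: integral_def tr_def div_greater_zero_iff gcd_le1_nat)
  hence "q0 \<le> q0 div gcd q0 r" by (rule least)
  hence cop: "coprime q0 r"
    using q0_pos r by (metis coprime_iff_gcd_eq_1 div_less_dividend gcd_pos_nat leD nat_neq_iff less_one)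
  have "q0 \<le> Q"
  proof -
    \<comment> \<open>The factor \<open>2 * q0\<close> keeps \<open>q0 * s\<close> below half the
      modulus, and a large \<open>n\<close> does so for \<open>q * a\<close>. Both represent
      \<open>q0 * q * t\<close>, hence they coincide.\<close>
    obtain n0 where n0: "\<And>n. n \<ge> n0 \<Longrightarrow> \<exists>q s. 0 < q \<and> q \<le> Q
        \<and> [s = int q * tr n] (mod int r ^ n) \<and> int (2 * q0) * \<bar>s\<bar> < int r ^ n"
      using approx[of "2 * q0"] by blast
    define n where "n = max n0 (nat (2 * int Q * \<bar>a\<bar>))"
    obtain q s where q: "0 < q" "q \<le> Q" and s: "[s = int q * tr n] (mod int r ^ n)"
        "int (2 * q0) * \<bar>s\<bar> < int r ^ n" using n0[of n] by (auto simp: n_def)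
    have "n < r ^ n" using assms(1) by (intro power_gt_expt) simp
    hence "int n < int r ^ n" by (metis of_nat_less_iff of_nat_power)
    moreover have "2 * int Q * \<bar>a\<bar> \<le> int n" by (simp add: n_def)
    moreover have "2 * int q * \<bar>a\<bar> \<le> 2 * int Q * \<bar>a\<bar>" using q by (intro mult_right_mono) auto
    ultimately have "2 * int q * \<bar>a\<bar> < int r ^ n" by linarith
    hence qa: "2 * \<bar>int q * a\<bar> < int r ^ n" by (simp add: abs_mult)
    have "int q0 * s = int q * a"
    proof (rule cong_int_eqI)
      have "[int q0 * s = int q0 * (int q * tr n)] (mod int r ^ n)"
        using s(1) by (rule cong_scalar_left)
      also have "int q0 * (int q * tr n) = int q * (int q0 * tr n)" by simp
      also have "[int q * (int q0 * tr n) = int q * a] (mod int r ^ n)"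
        using a by (rule cong_scalar_left)
      finally show "[int q0 * s = int q * a] (mod int r ^ n)" .
      show "\<bar>int q0 * s\<bar> + \<bar>int q * a\<bar> < int r ^ n" using qa s(2) by (simp add: abs_mult)
    qed
    \<comment> \<open>Now \<open>q0 * q * t = q0 * s\<close> holds to every precision, and
      \<open>q0\<close> cancels because it is coprime to \<open>r\<close>. So a
      \<open>q \<le> Q\<close> found at a single \<open>n\<close> works for all
      \<open>m\<close>.\<close>
    have "[int q * tr m = s] (mod int r ^ m)" for m
    proof -
      have "[int q0 * (int q * tr m) = int q0 * s] (mod int r ^ m)"
        using cong_scalar_left[OF a[of m], of "int q"]
        unfolding \<open>int q0 * s = int q * a\<close> by (simp only: mult.left_commute)
      moreover have "coprime (int q0) (int r ^ m)" using cop by simp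
      ultimately show ?thesis using cong_mult_lcancel by blast
    qed
    hence "integral q" using q(1) unfolding integral_def by blast
    from least[OF this] q(2) show ?thesis by simp
  qed
  \<comment> \<open>This gains the final 1: \<open>r ^ j\<close> is not coprime to \<open>r\<close>,
    as \<open>j > 0\<close> because the empty word occurs in the nonempty \<open>X\<close>.\<close>
  moreover have "q0 \<noteq> Q"
  proof
    assume "q0 = Q"
    have "j \<noteq> 0"
    proof
      assume "j = 0"
      obtain x where "x \<in> X" using X by (auto simp: sofic_shift_def)
      moreover have "w = map x [0..<0]" using assms(4) \<open>j = 0\<close> by simp
      ultimately have "w \<in> language X" unfolding language_def by blast
      with assms(5) show False by blast
    qed
    with cop \<open>q0 = Q\<close> have "coprime r r" by (simp add: Q_def)
    with assms(1) show False by simp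
  qed
  ultimately have "q0 \<le> r ^ j - 1" by (simp add: Q_def)
  moreover have "radic_nmult r q0 t \<in> radic_Ints r"
    using radic_nmult_IntsI[OF r, of q0 t a] a by (simp add: tr_def)
  ultimately show ?thesis using q0_pos cop by blast
qed

end
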